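(* Fix separable $M,N\models \mathsf{UDLO}$ and $\varepsilon>0$. Then there is a correlation $R_\varepsilon$ between $M$ and $N$ such that $\mathrm{dis}_{\overline{OGH}}(R_\varepsilon)\leq \varepsilon$, where $OGH=\{d(x,y), r(x,y)\}$. Thus $\mathsf{UDLO}$ is strongly $\overline{OGH}$-$\omega$-categorical.
   Context: A metric linear order is a set with a linear order $\le$ and metric $d$ such that every open ball is order-convex, treated in continuous logic in the language $\{d_\le,r\}$ with $r(x,y)=\inf_{z\le y}d(x,z)$ (distance to the ray $(-\infty,y]$) and $d_\le(x,y)$ the distance from $(x,y)$ to $\{(w,z):w\le z\}$. $\mathsf{UDLO}$ is the theory of complete metric linear orders of diameter $\le 1$ with ultrametric metric such that for every $a$ both $\{d(a,b):b<a\}$ and $\{d(a,b):b>a\}$ are dense in $[0,1]$. For a set of formulas $\Delta$, $\overline{\Delta}$ is its closure under renaming variables, quantification, $1$-Lipschitz connectives, logical equivalence modulo the theory, and uniform limits. A correlation between $M,N$ is a total surjective relation $R\subseteq M\times N$; $\mathrm{dis}_\Delta(R)=\sup\{|\phi^M(\bar m)-\phi^N(\bar n)|:\phi\in\Delta,\ (m_i,n_i)\in R\ \forall i\}$; $\rho_\Delta(M;N)$ is the infimum of $\mathrm{dis}_\Delta(R)$ over correlations. A theory is strongly $\Delta$-$\omega$-categorical if $\rho_\Delta(M;N)=0$ for any two of its models of density character $\omega$. *)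

theory Defs
  imports "HOL-Analysis.Analysis"
begin

section \<open>Metric linear orders\<close>

record 'u ordered_metric =
  met :: "'u metric"
  ord :: "'u rel"

abbreviation pts :: "'u ordered_metric \<Rightarrow> 'u set" where
  "pts M \<equiv> mspace (met M)"

abbreviation dst :: "'u ordered_metric \<Rightarrow> 'u \<Rightarrow> 'u \<Rightarrow> real" where
  "dst M \<equiv> mdist (met M)"

definition order_convex :: "'u ordered_metric \<Rightarrow> 'u set \<Rightarrow> bool" where
  "order_convex M B \<longleftrightarrow>
     (\<forall>x\<in>B. \<forall>z\<in>B. \<forall>y\<in>pts M. (x, y) \<in> ord M \<and> (y, z) \<in> ord M \<longrightarrow> y \<in> B)"

definition metric_linear_order :: "'u ordered_metric \<Rightarrow> bool" where
  "metric_linear_order M \<longleftrightarrow>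
     linear_order_on (pts M) (ord M) \<and>
     (\<forall>a\<in>pts M. \<forall>\<epsilon>>0. order_convex M (mball_of (met M) a \<epsilon>))"

definition ray_dist :: "'u ordered_metric \<Rightarrow> 'u \<Rightarrow> 'u \<Rightarrow> real" where
  "ray_dist M x y = Inf {dst M x z | z. (z, y) \<in> ord M}"

text \<open>The square of a metric structure carries the maximum metric, as usual in continuous logic.\<close>

definition le_dist :: "'u ordered_metric \<Rightarrow> 'u \<Rightarrow> 'u \<Rightarrow> real" where
  "le_dist M x y = Inf {max (dst M x w) (dst M y z) | w z. (w, z) \<in> ord M}"

text \<open>
  A theory is given by its models. All models live on subsets of one type \<open>'u\<close>, which is
  arbitrary. Every model of \<open>UDLO\<close> is a nonempty complete metric space without isolated points,
  so a type carrying a model has at least continuum many elements; by downward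
  Loewenheim-Skolem, equivalence modulo \<open>UDLO\<close> and uniform convergence modulo \<open>UDLO\<close> then do
  not depend on the choice of \<open>'u\<close>. Metric structures are nonempty.
\<close>

definition UDLO :: "'u ordered_metric set" where
  "UDLO = {M. metric_linear_order M \<and> pts M \<noteq> {} \<and> mcomplete_of (met M) \<and>
     (\<forall>x\<in>pts M. \<forall>y\<in>pts M. dst M x y \<le> 1) \<and>
     (\<forall>x\<in>pts M. \<forall>y\<in>pts M. \<forall>z\<in>pts M. dst M x z \<le> max (dst M x y) (dst M y z)) \<and>
     (\<forall>a\<in>pts M.
        {0..1} \<subseteq> closure {dst M a b | b. (b, a) \<in> ord M \<and> b \<noteq> a} \<and>
        {0..1} \<subseteq> closure {dst M a b | b. (a, b) \<in> ord M \<and> b \<noteq> a})}"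


section \<open>Continuous logic in the language of metric linear orders\<close>

text \<open>
  Variables are de Bruijn indices: \<open>SupQ\<close> and \<open>InfQ\<close> bind index 0 and shift the others.
  A connective takes its arguments as a list; only its values on lists of the right length matter.
  \<open>Lim\<close> denotes the limit of a sequence of formulas.
\<close>

datatype fm =
    Dist nat nat
  | LeDist nat nat
  | Ray nat nat
  | Conn "real list \<Rightarrow> real" "fm list"
  | SupQ fm
  | InfQ fm
  | Lim "nat \<Rightarrow> fm"

primrec eval :: "fm \<Rightarrow> 'u ordered_metric \<Rightarrow> (nat \<Rightarrow> 'u) \<Rightarrow> real" where
  "eval (Dist i j) = (\<lambda>M e. dst M (e i) (e j))"
| "eval (LeDist i j) = (\<lambda>M e. le_dist M (e i) (e j))"
| "eval (Ray i j) = (\<lambda>M e. ray_dist M (e i) (e j))"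
| "eval (Conn u \<phi>s) = (\<lambda>M e. u (map (\<lambda>f. f M e) (map eval \<phi>s)))"
| "eval (SupQ \<phi>) = (\<lambda>M e. SUP a\<in>pts M. eval \<phi> M (case_nat a e))"
| "eval (InfQ \<phi>) = (\<lambda>M e. INF a\<in>pts M. eval \<phi> M (case_nat a e))"
| "eval (Lim F) = (\<lambda>M e. lim (\<lambda>n. eval (F n) M e))"

primrec rename :: "fm \<Rightarrow> (nat \<Rightarrow> nat) \<Rightarrow> fm" where
  "rename (Dist i j) = (\<lambda>\<sigma>. Dist (\<sigma> i) (\<sigma> j))"
| "rename (LeDist i j) = (\<lambda>\<sigma>. LeDist (\<sigma> i) (\<sigma> j))"
| "rename (Ray i j) = (\<lambda>\<sigma>. Ray (\<sigma> i) (\<sigma> j))"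
| "rename (Conn u \<phi>s) = (\<lambda>\<sigma>. Conn u (map (\<lambda>f. f \<sigma>) (map rename \<phi>s)))"
| "rename (SupQ \<phi>) = (\<lambda>\<sigma>. SupQ (rename \<phi> (case_nat 0 (Suc \<circ> \<sigma>))))"
| "rename (InfQ \<phi>) = (\<lambda>\<sigma>. InfQ (rename \<phi> (case_nat 0 (Suc \<circ> \<sigma>))))"
| "rename (Lim F) = (\<lambda>\<sigma>. Lim (\<lambda>n. rename (F n) \<sigma>))"

definition sup_dist :: "real list \<Rightarrow> real list \<Rightarrow> real" where
  "sup_dist xs ys = Max (insert 0 {\<bar>xs ! i - ys ! i\<bar> | i. i < length xs})"

definition continuous_connective :: "nat \<Rightarrow> (real list \<Rightarrow> real) \<Rightarrow> bool" where
  "continuous_connective n u \<longleftrightarrow>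
     (\<forall>xs. length xs = n \<longrightarrow> (\<forall>\<epsilon>>0. \<exists>\<delta>>0. \<forall>ys. length ys = n \<longrightarrow>
        sup_dist xs ys < \<delta> \<longrightarrow> \<bar>u xs - u ys\<bar> < \<epsilon>))"

definition lipschitz1_connective :: "nat \<Rightarrow> (real list \<Rightarrow> real) \<Rightarrow> bool" where
  "lipschitz1_connective n u \<longleftrightarrow>
     (\<forall>xs ys. length xs = n \<longrightarrow> length ys = n \<longrightarrow> \<bar>u xs - u ys\<bar> \<le> sup_dist xs ys)"

definition valuations :: "'u ordered_metric set \<Rightarrow> ('u ordered_metric \<times> (nat \<Rightarrow> 'u)) set" where
  "valuations T = {(M, e). M \<in> T \<and> range e \<subseteq> pts M}"

definition unif_convergent :: "'u ordered_metric set \<Rightarrow> (nat \<Rightarrow> fm) \<Rightarrow> bool" where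
  "unif_convergent T F \<longleftrightarrow>
     uniformly_convergent_on (valuations T) (\<lambda>n (M, e). eval (F n) M e)"

definition equiv_mod :: "'u ordered_metric set \<Rightarrow> fm \<Rightarrow> fm \<Rightarrow> bool" where
  "equiv_mod T \<phi> \<psi> \<longleftrightarrow> (\<forall>(M, e)\<in>valuations T. eval \<phi> M e = eval \<psi> M e)"

text \<open>The well-formed expressions of \<^typ>\<open>fm\<close>, i.e. the formulas, relative to a theory.\<close>

inductive_set formulas :: "'u ordered_metric set \<Rightarrow> fm set"
  for T :: "'u ordered_metric set" where
  "Dist i j \<in> formulas T"
| "LeDist i j \<in> formulas T"
| "Ray i j \<in> formulas T"
| "\<lbrakk>continuous_connective (length \<phi>s) u; \<forall>\<phi>\<in>set \<phi>s. \<phi> \<in> formulas T\<rbrakk> \<Longrightarrow> Conn u \<phi>s \<in> formulas T"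
| "\<phi> \<in> formulas T \<Longrightarrow> SupQ \<phi> \<in> formulas T"
| "\<phi> \<in> formulas T \<Longrightarrow> InfQ \<phi> \<in> formulas T"
| "\<lbrakk>\<And>n. F n \<in> formulas T; unif_convergent T F\<rbrakk> \<Longrightarrow> Lim F \<in> formulas T"

text \<open>
  The closure of a set of formulas. Quantification over an arbitrary variable is
  renaming followed by quantification over index 0.
\<close>

inductive_set fm_closure :: "'u ordered_metric set \<Rightarrow> fm set \<Rightarrow> fm set"
  for T :: "'u ordered_metric set" and \<Delta> :: "fm set" where
  base: "\<phi> \<in> \<Delta> \<Longrightarrow> \<phi> \<in> fm_closure T \<Delta>"
| rename: "\<phi> \<in> fm_closure T \<Delta> \<Longrightarrow> rename \<phi> \<sigma> \<in> fm_closure T \<Delta>"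
| SupQ: "\<phi> \<in> fm_closure T \<Delta> \<Longrightarrow> SupQ \<phi> \<in> fm_closure T \<Delta>"
| InfQ: "\<phi> \<in> fm_closure T \<Delta> \<Longrightarrow> InfQ \<phi> \<in> fm_closure T \<Delta>"
| Conn: "\<lbrakk>lipschitz1_connective (length \<phi>s) u; \<forall>\<phi>\<in>set \<phi>s. \<phi> \<in> fm_closure T \<Delta>\<rbrakk>
    \<Longrightarrow> Conn u \<phi>s \<in> fm_closure T \<Delta>"
| equiv: "\<lbrakk>\<phi> \<in> fm_closure T \<Delta>; \<psi> \<in> formulas T; equiv_mod T \<phi> \<psi>\<rbrakk> \<Longrightarrow> \<psi> \<in> fm_closure T \<Delta>"
| Lim: "\<lbrakk>\<And>n. F n \<in> fm_closure T \<Delta>; unif_convergent T F\<rbrakk> \<Longrightarrow> Lim F \<in> fm_closure T \<Delta>"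

definition OGH :: "fm set" where
  "OGH = {Dist 0 1, Ray 0 1}"


section \<open>Correlations and approximate categoricity\<close>

definition correlation :: "'u ordered_metric \<Rightarrow> 'u ordered_metric \<Rightarrow> 'u rel \<Rightarrow> bool" where
  "correlation M N R \<longleftrightarrow>
     R \<subseteq> pts M \<times> pts N \<and> (\<forall>m\<in>pts M. \<exists>n. (m, n) \<in> R) \<and> (\<forall>n\<in>pts N. \<exists>m. (m, n) \<in> R)"

definition distortion ::
  "fm set \<Rightarrow> 'u ordered_metric \<Rightarrow> 'u ordered_metric \<Rightarrow> 'u rel \<Rightarrow> ereal" where
  "distortion \<Delta> M N R =
     Sup {ereal \<bar>eval \<phi> M m - eval \<phi> N n\<bar> | \<phi> m n. \<phi> \<in> \<Delta> \<and> (\<forall>i. (m i, n i) \<in> R)}"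

definition rho :: "fm set \<Rightarrow> 'u ordered_metric \<Rightarrow> 'u ordered_metric \<Rightarrow> ereal" where
  "rho \<Delta> M N = Inf {distortion \<Delta> M N R | R. correlation M N R}"

abbreviation separable :: "'u ordered_metric \<Rightarrow> bool" where
  "separable M \<equiv> separable_space (mtopology_of (met M))"

text \<open>The least cardinality of a dense subset is countably infinite.\<close>

definition density_character_omega :: "'u ordered_metric \<Rightarrow> bool" where
  "density_character_omega M \<longleftrightarrow> separable M \<and>
     (\<forall>D. D \<subseteq> pts M \<and> mtopology_of (met M) closure_of D = pts M \<longrightarrow> infinite D)"

definition strongly_omega_categorical :: "fm set \<Rightarrow> 'u ordered_metric set \<Rightarrow> bool" where
  "strongly_omega_categorical \<Delta> T \<longleftrightarrow>
     (\<forall>M\<in>T. \<forall>N\<in>T. density_character_omega M \<and> density_character_omega N \<longrightarrow> rho \<Delta> M N = 0)"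

end

theory Submission
  imports Defs
begin

text \<open>
  Every closure operation preserves distortion bounds, so only \<open>d\<close> and \<open>r\<close> matter. Since balls
  are convex, \<open>r(x, y)\<close> is \<open>d(x, y)\<close> if \<open>y < x\<close> and 0 otherwise. Cut \<open>[0, 1]\<close> into finitely many
  intervals of length at most \<open>\<epsilon>\<close> and remember of \<open>d\<close> only the interval containing the
  distance: this is an ultrametric with finitely many values, in which every value is realised on
  both sides of each point and, by density of the distances, also inside every interval of that
  size. Points in the first interval are identified. In this discretised language the
  separable models have countable dense orders of classes, and a back-and-forth argument matches
  them exactly; the resulting correlation has distortion at most \<open>\<epsilon>\<close>.
\<close>

section \<open>Distortion of the closure of a set of formulas\<close>

lemma eval_rename: "eval (rename \<phi> \<sigma>) M e = eval \<phi> M (e \<circ> \<sigma>)"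
proof (induction \<phi> arbitrary: \<sigma> e)
  case (Conn u \<phi>s)
  then have "map (\<lambda>f. f M e) (map eval (map (\<lambda>f. f \<sigma>) (map rename \<phi>s))) =
      map (\<lambda>f. f M (e \<circ> \<sigma>)) (map eval \<phi>s)"
    by (simp add: comp_def)
  then show ?case
    by (simp only: rename.simps eval.simps)
next
  case (SupQ \<phi>)
  have *: "case_nat a e \<circ> case_nat 0 (Suc \<circ> \<sigma>) = case_nat a (e \<circ> \<sigma>)" for a
    by (auto simp: fun_eq_iff split: nat.splits)
  show ?case
    by (simp only: rename.simps eval.simps SupQ.IH *)
next
  case (InfQ \<phi>)
  have *: "case_nat a e \<circ> case_nat 0 (Suc \<circ> \<sigma>) = case_nat a (e \<circ> \<sigma>)" for a
    by (auto simp: fun_eq_iff split: nat.splits)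
  show ?case
    by (simp only: rename.simps eval.simps InfQ.IH *)
qed auto

lemma sup_dist_le:
  assumes "length xs = length ys" and "0 \<le> c"
    and "\<And>i. i < length xs \<Longrightarrow> \<bar>xs ! i - ys ! i\<bar> \<le> c"
  shows "sup_dist xs ys \<le> c"
  unfolding sup_dist_def using assms by (subst Max_le_iff) auto

text \<open>\<open>eval\<close> of \<open>Lim\<close> is the pointwise \<open>lim\<close>, whereas
  uniform convergence only supplies some limit function. By uniqueness of limits the two agree on
  every valuation.\<close>

lemma unif_convergent_limit:
  assumes "unif_convergent T F"
  shows "uniform_limit (valuations T) (\<lambda>n (M, e). eval (F n) M e)
           (\<lambda>(M, e). eval (Lim F) M e) sequentially"
proof -
  obtain l where l: "uniform_limit (valuations T) (\<lambda>n (M, e). eval (F n) M e) l sequentially"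
    using assms unfolding unif_convergent_def uniformly_convergent_on_def by blast
  have "l (M, e) = eval (Lim F) M e" if "(M, e) \<in> valuations T" for M e
    using tendsto_uniform_limitI[OF l that] by (auto dest!: limI)
  then have "uniform_limit (valuations T) (\<lambda>n (M, e). eval (F n) M e) l sequentially \<longleftrightarrow> ?thesis"
    by (intro uniform_limit_cong') auto
  with l show ?thesis by blast
qed

text \<open>This serves the quantifier case: totality and surjectivity of a correlation give
  partners in both directions, so each supremum exceeds the other by at most \<open>c\<close>. The
  boundedness assumptions are what makes a real \<open>SUP\<close> a genuine supremum.\<close>

lemma abs_SUP_diff_le:
  fixes f :: "'a \<Rightarrow> real" and g :: "'b \<Rightarrow> real"
  assumes "A \<noteq> {}" "B \<noteq> {}" "bdd_above (f ` A)" "bdd_above (g ` B)"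
    and fg: "\<And>a. a \<in> A \<Longrightarrow> \<exists>b\<in>B. \<bar>f a - g b\<bar> \<le> c"
    and gf: "\<And>b. b \<in> B \<Longrightarrow> \<exists>a\<in>A. \<bar>f a - g b\<bar> \<le> c"
  shows "\<bar>(SUP a\<in>A. f a) - (SUP b\<in>B. g b)\<bar> \<le> c"
proof -
  have "(SUP a\<in>A. f a) \<le> (SUP b\<in>B. g b) + c"
  proof (rule cSUP_least)
    fix a assume "a \<in> A"
    then obtain b where b: "b \<in> B" "\<bar>f a - g b\<bar> \<le> c" using fg by blast
    then have "g b \<le> (SUP b\<in>B. g b)" using assms by (intro cSUP_upper)
    with b show "f a \<le> (SUP b\<in>B. g b) + c" by linarith
  qed fact
  moreover have "(SUP b\<in>B. g b) \<le> (SUP a\<in>A. f a) + c"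
  proof (rule cSUP_least)
    fix b assume "b \<in> B"
    then obtain a where a: "a \<in> A" "\<bar>f a - g b\<bar> \<le> c" using gf by blast
    then have "f a \<le> (SUP a\<in>A. f a)" using assms by (intro cSUP_upper)
    with a show "g b \<le> (SUP a\<in>A. f a) + c" by linarith
  qed fact
  ultimately show ?thesis by linarith
qed

lemma abs_INF_diff_le:
  fixes f :: "'a \<Rightarrow> real" and g :: "'b \<Rightarrow> real"
  assumes "A \<noteq> {}" "B \<noteq> {}" "bdd_below (f ` A)" "bdd_below (g ` B)"
    and fg: "\<And>a. a \<in> A \<Longrightarrow> \<exists>b\<in>B. \<bar>f a - g b\<bar> \<le> c"
    and gf: "\<And>b. b \<in> B \<Longrightarrow> \<exists>a\<in>A. \<bar>f a - g b\<bar> \<le> c"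
  shows "\<bar>(INF a\<in>A. f a) - (INF b\<in>B. g b)\<bar> \<le> c"
proof -
  have "(INF b\<in>B. g b) - c \<le> (INF a\<in>A. f a)"
  proof (rule cINF_greatest)
    fix a assume "a \<in> A"
    then obtain b where b: "b \<in> B" "\<bar>f a - g b\<bar> \<le> c" using fg by blast
    then have "(INF b\<in>B. g b) \<le> g b" using assms by (intro cINF_lower)
    with b show "(INF b\<in>B. g b) - c \<le> f a" by linarith
  qed fact
  moreover have "(INF a\<in>A. f a) - c \<le> (INF b\<in>B. g b)"
  proof (rule cINF_greatest)
    fix b assume "b \<in> B"
    then obtain a where a: "a \<in> A" "\<bar>f a - g b\<bar> \<le> c" using gf by blast
    then have "(INF a\<in>A. f a) \<le> f a" using assms by (intro cINF_lower)
    with a show "(INF a\<in>A. f a) - c \<le> g b" by linarith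
  qed fact
  ultimately show ?thesis by linarith
qed

section \<open>Uniform bounds and distortion bounds over the closure\<close>

lemma valuationsD:
  assumes "(M, e) \<in> valuations T"
  shows "M \<in> T" "range e \<subseteq> pts M" "pts M \<noteq> {}"
  using assms unfolding valuations_def by auto

lemma valuations_comp: "(M, e) \<in> valuations T \<Longrightarrow> (M, e \<circ> \<sigma>) \<in> valuations T"
  unfolding valuations_def by auto

lemma valuations_case_nat:
  "(M, e) \<in> valuations T \<Longrightarrow> a \<in> pts M \<Longrightarrow> (M, case_nat a e) \<in> valuations T"
  unfolding valuations_def by (auto split: nat.splits dest: range_subsetD)

text \<open>Real suprema and infima are meaningful only on bounded sets, so the quantifier cases of
  \<open>fm_closure_distortion\<close> depend on this bound. It survives connectives because a
  1-Lipschitz function on a bounded cube stays close to its value at the origin.\<close>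

lemma fm_closure_bounded:
  fixes T :: "'u ordered_metric set"
  assumes "\<phi> \<in> fm_closure T \<Delta>"
    and base: "\<And>\<phi>. \<phi> \<in> \<Delta> \<Longrightarrow> \<exists>C. \<forall>(M, e)\<in>valuations T. \<bar>eval \<phi> M e\<bar> \<le> C"
  shows "\<exists>C. \<forall>(M, e)\<in>valuations T. \<bar>eval \<phi> M e\<bar> \<le> C"
  using assms(1)
proof induction
  case (base \<phi>)
  then show ?case by (rule assms(2))
next
  case (rename \<phi> \<sigma>)
  then show ?case using valuations_comp by (fastforce simp: eval_rename)
next
  case (SupQ \<phi>)
  then obtain C where C: "\<And>M e. (M, e) \<in> valuations T \<Longrightarrow> \<bar>eval \<phi> M e\<bar> \<le> C"
    by blast
  have "\<bar>SUP a\<in>pts M. eval \<phi> M (case_nat a e)\<bar> \<le> C" if e: "(M, e) \<in> valuations T" for M e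
    using C[OF valuations_case_nat[OF e]] valuationsD(3)[OF e]
    by (intro cSup_abs_le) auto
  then show ?case by auto
next
  case (InfQ \<phi>)
  then obtain C where C: "\<And>M e. (M, e) \<in> valuations T \<Longrightarrow> \<bar>eval \<phi> M e\<bar> \<le> C"
    by blast
  have "\<bar>INF a\<in>pts M. eval \<phi> M (case_nat a e)\<bar> \<le> C" if e: "(M, e) \<in> valuations T" for M e
    using C[OF valuations_case_nat[OF e]] valuationsD(3)[OF e]
    by (intro cInf_abs_ge) auto
  then show ?case by auto
next
  case (Conn \<phi>s u)
  then have "\<forall>\<phi>\<in>set \<phi>s. \<exists>C. \<forall>(M, e)\<in>valuations T. \<bar>eval \<phi> M e\<bar> \<le> C" by blast
  then obtain C where C: "\<And>\<phi> M e. \<phi> \<in> set \<phi>s \<Longrightarrow> (M, e) \<in> valuations T \<Longrightarrow> \<bar>eval \<phi> M e\<bar> \<le> C \<phi>"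
    by (metis (mono_tags, lifting) case_prodD)
  \<comment> \<open>Inserting 0 makes \<open>B\<close> nonnegative and covers connectives without
    arguments. The zero list \<open>z\<close> is the reference point for the Lipschitz
    estimate.\<close>
  define B where "B = Max (insert 0 (C ` set \<phi>s))"
  define z where "z = replicate (length \<phi>s) (0::real)"
  have B: "0 \<le> B" "\<And>\<phi>. \<phi> \<in> set \<phi>s \<Longrightarrow> C \<phi> \<le> B"
    unfolding B_def by auto
  have "\<bar>eval (Conn u \<phi>s) M e\<bar> \<le> \<bar>u z\<bar> + B" if e: "(M, e) \<in> valuations T" for M e
  proof -
    define xs where "xs = map (\<lambda>f. f M e) (map eval \<phi>s)"
    have "sup_dist xs z \<le> B"
      using B order_trans[OF C[OF _ e] B(2)] by (intro sup_dist_le) (auto simp: xs_def z_def)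
    moreover have "\<bar>u xs - u z\<bar> \<le> sup_dist xs z"
      using Conn.hyps unfolding lipschitz1_connective_def by (simp add: xs_def z_def)
    ultimately show ?thesis by (simp add: xs_def)
  qed
  then show ?case by blast
next
  case (equiv \<phi> \<psi>)
  then show ?case unfolding equiv_mod_def by fastforce
next
  case (Lim F)
  \<comment> \<open>A single approximant uniformly within 1 of the limit suffices for a
    bound.\<close>
  then have "\<forall>\<^sub>F n in sequentially. \<forall>x\<in>valuations T.
      dist ((\<lambda>(M, e). eval (F n) M e) x) ((\<lambda>(M, e). eval (Lim F) M e) x) < 1"
    by (intro uniform_limitD[OF unif_convergent_limit]) auto
  then obtain n where n: "\<forall>x\<in>valuations T.
      dist ((\<lambda>(M, e). eval (F n) M e) x) ((\<lambda>(M, e). eval (Lim F) M e) x) < 1"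
    by (auto simp: eventually_sequentially)
  obtain C where C: "\<And>M e. (M, e) \<in> valuations T \<Longrightarrow> \<bar>eval (F n) M e\<bar> \<le> C"
    using Lim.IH[of n] by blast
  have "\<bar>eval (Lim F) M e\<bar> \<le> C + 1" if e: "(M, e) \<in> valuations T" for M e
    using C[OF e] n[rule_format, OF e] by (simp add: dist_real_def)
  then show ?case by blast
qed

text \<open>No closure operation enlarges the difference of values: connectives are 1-Lipschitz,
  quantified points are matched through \<open>R\<close>, equivalence holds in both models, and
  non-strict bounds pass to limits. The induction leaves \<open>m\<close> and \<open>n\<close>
  arbitrary so that quantifiers can prepend a related pair to related tuples.\<close>

lemma fm_closure_distortion:
  fixes T :: "'u ordered_metric set"
  assumes "\<phi> \<in> fm_closure T \<Delta>"
    and T: "M \<in> T" "N \<in> T" and R: "correlation M N R"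
    and bdd: "\<And>\<phi>. \<phi> \<in> \<Delta> \<Longrightarrow> \<exists>C. \<forall>(M, e)\<in>valuations T. \<bar>eval \<phi> M e\<bar> \<le> C"
    and base: "\<And>\<phi> m n. \<phi> \<in> \<Delta> \<Longrightarrow> (\<And>i. (m i, n i) \<in> R) \<Longrightarrow> \<bar>eval \<phi> M m - eval \<phi> N n\<bar> \<le> \<epsilon>"
    and \<epsilon>: "0 \<le> \<epsilon>" and mn: "\<And>i. (m i, n i) \<in> R"
  shows "\<bar>eval \<phi> M m - eval \<phi> N n\<bar> \<le> \<epsilon>"
proof -
  have val: "(M, m) \<in> valuations T" "(N, n) \<in> valuations T" if "\<And>i. (m i, n i) \<in> R" for m n
    using that R T unfolding valuations_def correlation_def by blast+
  have case_nat_R: "(case_nat a m i, case_nat b n i) \<in> R"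
    if "(a, b) \<in> R" "\<And>i. (m i, n i) \<in> R" for a b m n i
    using that by (cases i) auto
  have bounds: "\<exists>C. (\<forall>a\<in>pts M. \<bar>eval \<phi> M (case_nat a m)\<bar> \<le> C) \<and>
      (\<forall>b\<in>pts N. \<bar>eval \<phi> N (case_nat b n)\<bar> \<le> C)"
    if "\<phi> \<in> fm_closure T \<Delta>" "\<And>i. (m i, n i) \<in> R" for \<phi> m n
    using fm_closure_bounded[OF that(1) bdd] val[OF that(2)] valuations_case_nat by fast
  have partner: "\<exists>b\<in>pts N. (a, b) \<in> R" if "a \<in> pts M" for a
    using that R unfolding correlation_def by blast
  have partner': "\<exists>a\<in>pts M. (a, b) \<in> R" if "b \<in> pts N" for b
    using that R unfolding correlation_def by blast
  show ?thesis
    using assms(1) mn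
  proof (induction arbitrary: m n)
    case (base \<phi>)
    then show ?case by (rule assms(6))
  next
    case (rename \<phi> \<sigma>)
    then show ?case by (simp add: eval_rename)
  next
    case (SupQ \<phi>)
    have ne: "pts M \<noteq> {}" "pts N \<noteq> {}"
      using val[of m n, OF SupQ.prems] valuationsD by blast+
    obtain C where C: "\<And>a. a \<in> pts M \<Longrightarrow> \<bar>eval \<phi> M (case_nat a m)\<bar> \<le> C"
        "\<And>b. b \<in> pts N \<Longrightarrow> \<bar>eval \<phi> N (case_nat b n)\<bar> \<le> C"
      using bounds[of \<phi> m n, OF SupQ.hyps SupQ.prems] by blast
    have close: "\<bar>eval \<phi> M (case_nat a m) - eval \<phi> N (case_nat b n)\<bar> \<le> \<epsilon>" if "(a, b) \<in> R" for a b
      by (rule SupQ.IH) (rule case_nat_R[OF that SupQ.prems])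
    have "bdd_above ((\<lambda>a. eval \<phi> M (case_nat a m)) ` pts M)"
      "bdd_above ((\<lambda>b. eval \<phi> N (case_nat b n)) ` pts N)"
      using C by (auto intro!: bdd_aboveI2[where M = C] dest: abs_le_D1)
    then show ?case
      using close partner partner' unfolding eval.simps
      by (intro abs_SUP_diff_le[OF ne]) blast+
  next
    case (InfQ \<phi>)
    have ne: "pts M \<noteq> {}" "pts N \<noteq> {}"
      using val[of m n, OF InfQ.prems] valuationsD by blast+
    obtain C where C: "\<And>a. a \<in> pts M \<Longrightarrow> \<bar>eval \<phi> M (case_nat a m)\<bar> \<le> C"
        "\<And>b. b \<in> pts N \<Longrightarrow> \<bar>eval \<phi> N (case_nat b n)\<bar> \<le> C"
      using bounds[of \<phi> m n, OF InfQ.hyps InfQ.prems] by blast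
    have close: "\<bar>eval \<phi> M (case_nat a m) - eval \<phi> N (case_nat b n)\<bar> \<le> \<epsilon>" if "(a, b) \<in> R" for a b
      by (rule InfQ.IH) (rule case_nat_R[OF that InfQ.prems])
    have "- C \<le> eval \<phi> M (case_nat a m)" if "a \<in> pts M" for a
      using C(1)[OF that] by linarith
    moreover have "- C \<le> eval \<phi> N (case_nat b n)" if "b \<in> pts N" for b
      using C(2)[OF that] by linarith
    ultimately have "bdd_below ((\<lambda>a. eval \<phi> M (case_nat a m)) ` pts M)"
      "bdd_below ((\<lambda>b. eval \<phi> N (case_nat b n)) ` pts N)"
      by (auto intro!: bdd_belowI2[where m = "- C"])
    then show ?case
      using close partner partner' unfolding eval.simps
      by (intro abs_INF_diff_le[OF ne]) blast+
  next
    case (Conn \<phi>s u)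
    define xs where "xs = map (\<lambda>f. f M m) (map eval \<phi>s)"
    define ys where "ys = map (\<lambda>f. f N n) (map eval \<phi>s)"
    have "sup_dist xs ys \<le> \<epsilon>"
      using Conn \<epsilon> by (intro sup_dist_le) (auto simp: xs_def ys_def)
    moreover have "\<bar>u xs - u ys\<bar> \<le> sup_dist xs ys"
      using Conn.hyps unfolding lipschitz1_connective_def by (simp add: xs_def ys_def)
    ultimately show ?case by (simp add: xs_def ys_def)
  next
    case (equiv \<phi> \<psi>)
    have "eval \<phi> M m = eval \<psi> M m" "eval \<phi> N n = eval \<psi> N n"
      using equiv.hyps(3) val[of m n, OF equiv.prems] unfolding equiv_mod_def by blast+
    then show ?case
      using equiv.IH[of m n, OF equiv.prems] by simp
  next
    case (Lim F)
    note lim = tendsto_uniform_limitI[OF unif_convergent_limit[OF Lim.hyps(2)]]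
    have "(\<lambda>k. eval (F k) M m) \<longlonglongrightarrow> eval (Lim F) M m" "(\<lambda>k. eval (F k) N n) \<longlonglongrightarrow> eval (Lim F) N n"
      using lim[OF val(1)[of m n, OF Lim.prems]] lim[OF val(2)[of m n, OF Lim.prems]] by simp_all
    then have "(\<lambda>k. \<bar>eval (F k) M m - eval (F k) N n\<bar>) \<longlonglongrightarrow> \<bar>eval (Lim F) M m - eval (Lim F) N n\<bar>"
      by (intro tendsto_intros)
    then show ?case
      by (rule LIMSEQ_le_const2) (intro exI allI impI Lim.IH Lim.prems)
  qed
qed


section \<open>Back and forth between levelled orders\<close>

text \<open>
  \<open>lt\<close> is a strict weak order whose incomparability classes are the classes of level 0, and
  \<open>L\<close> is an ultrametric with finitely many values.
\<close>

locale level_order =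
  fixes X :: "'a set" and lt :: "'a \<Rightarrow> 'a \<Rightarrow> bool" and L :: "'a \<Rightarrow> 'a \<Rightarrow> nat" and K :: nat
  assumes L_self: "x \<in> X \<Longrightarrow> L x x = 0"
    and L_sym: "L x y = L y x"
    and L_ultra: "\<lbrakk>x \<in> X; y \<in> X; z \<in> X\<rbrakk> \<Longrightarrow> L x z \<le> max (L x y) (L y z)"
    and L_less: "\<lbrakk>x \<in> X; y \<in> X\<rbrakk> \<Longrightarrow> L x y < K"
    and L_pos_iff: "\<lbrakk>x \<in> X; y \<in> X\<rbrakk> \<Longrightarrow> 0 < L x y \<longleftrightarrow> lt x y \<or> lt y x"
    and lt_asym: "\<lbrakk>x \<in> X; y \<in> X; lt x y\<rbrakk> \<Longrightarrow> \<not> lt y x"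
    and lt_trans: "\<lbrakk>x \<in> X; y \<in> X; z \<in> X; lt x y; lt y z\<rbrakk> \<Longrightarrow> lt x z"
    and lt_convex: "\<lbrakk>x \<in> X; y \<in> X; z \<in> X; lt x y; lt y z\<rbrakk> \<Longrightarrow> L x y \<le> L x z \<and> L y z \<le> L x z"
    and right: "\<lbrakk>x \<in> X; 0 < i; i < K\<rbrakk> \<Longrightarrow> \<exists>y\<in>X. lt x y \<and> L x y = i"
    and left: "\<lbrakk>x \<in> X; 0 < i; i < K\<rbrakk> \<Longrightarrow> \<exists>y\<in>X. lt y x \<and> L x y = i"
    and between: "\<lbrakk>x \<in> X; y \<in> X; lt x y\<rbrakk> \<Longrightarrow>
      \<exists>z\<in>X. lt x z \<and> lt z y \<and> L x z = L x y \<and> L z y = L x y"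
begin

text \<open>The axioms are symmetric under order reversal, so facts about one side of a point also
  yield their mirror images.\<close>

lemma dual: "level_order X (\<lambda>x y. lt y x) L K"
proof
  fix x y assume "x \<in> X" "y \<in> X" "lt y x"
  then obtain z where "z \<in> X" "lt y z" "lt z x" "L y z = L y x" "L z x = L y x"
    using between[of y x] by blast
  then show "\<exists>z\<in>X. lt z x \<and> lt y z \<and> L x z = L x y \<and> L z y = L x y"
    using L_sym[of x y] L_sym[of x z] L_sym[of y z] by auto
next
  fix x y z assume "x \<in> X" "y \<in> X" "z \<in> X" "lt y x" "lt z y"
  then show "L x y \<le> L x z \<and> L y z \<le> L x z"
    using lt_convex[of z y x] L_sym[of x y] L_sym[of x z] L_sym[of y z] by auto
qed (fact L_self L_sym L_ultra L_less left right
    | (use L_pos_iff lt_asym lt_trans in blast))+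

lemma lt_irrefl: "x \<in> X \<Longrightarrow> \<not> lt x x"
  using lt_asym by blast

text \<open>This is the isosceles property of ultrametrics: the longest side of a triangle occurs
  twice.\<close>

lemma L_shift:
  assumes "x \<in> X" "x' \<in> X" "y \<in> X" "L x x' < L x y"
  shows "L x' y = L x y"
  using assms L_ultra[of x x' y] L_ultra[of x' x y] L_sym[of x x'] by linarith

text \<open>Otherwise \<open>y\<close> would lie strictly between \<open>x\<close> and
  \<open>x'\<close>, and convexity would bound \<open>L x y\<close> by the smaller
  \<open>L x x'\<close>.\<close>

lemma lt_shift:
  assumes "x \<in> X" "x' \<in> X" "y \<in> X" "L x x' < L x y" "lt x y"
  shows "lt x' y"
proof (rule ccontr)
  assume "\<not> lt x' y"
  then have "lt y x'"
    using L_shift[OF assms(1-4)] assms L_pos_iff by (metis gr_zeroI not_less0)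
  then show False
    using lt_convex[of x y x'] assms by auto
qed

lemma shift:
  assumes "x \<in> X" "x' \<in> X" "y \<in> X" "L x x' < L x y"
  shows "L x' y = L x y" "lt x' y \<longleftrightarrow> lt x y" "lt y x' \<longleftrightarrow> lt y x"
proof -
  interpret dual: level_order X "\<lambda>x y. lt y x" L K by (rule dual)
  show L: "L x' y = L x y"
    using L_shift[OF assms] .
  \<comment> \<open>The hypothesis has become symmetric in \<open>x\<close> and \<open>x'\<close>,
    so \<open>lt_shift\<close> applies in both directions, for the order and for its dual.\<close>
  then have "L x' x < L x' y"
    using assms L_sym[of x x'] by simp
  then show "lt x' y \<longleftrightarrow> lt x y" "lt y x' \<longleftrightarrow> lt y x"
    using assms lt_shift[of x x' y] lt_shift[of x' x y]
      dual.lt_shift[of x x' y] dual.lt_shift[of x' x y] by blast+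
qed

text \<open>At positive level, \<open>shift\<close> replaces one coordinate at a time; at level 0,
  both pairs are incomparable. This later extends an exact matching of dense sets to all
  points.\<close>

lemma congruence:
  assumes "x \<in> X" "y \<in> X" "x' \<in> X" "y' \<in> X" "L x x' = 0" "L y y' = 0"
  shows "L x y = L x' y'" "lt x y \<longleftrightarrow> lt x' y'"
proof -
  have "L x y = L x' y' \<and> (lt x y \<longleftrightarrow> lt x' y')"
  proof (cases "L x y = 0")
    case True
    then have "L x' y' = 0"
      using assms L_ultra[of x' x y'] L_ultra[of x y y'] L_sym[of x' x] by simp
    with True show ?thesis
      using assms L_pos_iff[of x y] L_pos_iff[of x' y'] by simp
  next
    case False
    have 1: "L x' y = L x y" "lt x' y \<longleftrightarrow> lt x y"
      using shift[of x x' y] assms False by simp_all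
    then have "L y y' < L y x'"
      using assms(6) False L_sym[of y x'] by simp
    then have "L y' x' = L y x'" "lt x' y' \<longleftrightarrow> lt x' y"
      using shift[of y y' x'] assms by simp_all
    with 1 show ?thesis
      using L_sym[of x' y'] L_sym[of x' y] by simp
  qed
  then show "L x y = L x' y'" "lt x y \<longleftrightarrow> lt x' y'" by simp_all
qed

text \<open>A new point is placed against one extremal point \<open>b'\<close> only, and this
  carries its position over to the other points \<open>b\<close>. If \<open>b\<close> precedes
  \<open>b'\<close>, convexity and the ultrametric inequality pin down the level; otherwise both lie
  in one class of level 0 and \<open>shift\<close> applies.\<close>

lemma beyond_right:
  assumes "b \<in> X" "b' \<in> X" "d \<in> X" "lt b' d" "L b b' \<le> L b' d" "\<not> lt b' b"
  shows "lt b d \<and> L b d = L b' d"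
proof (cases "lt b b'")
  case True
  then have "lt b d" "L b' d \<le> L b d"
    using assms lt_trans[of b b' d] lt_convex[of b b' d] by auto
  moreover have "L b d \<le> L b' d"
    using L_ultra[of b b' d] assms by simp
  ultimately show ?thesis by simp
next
  case False
  then have "L b' b = 0"
    using assms L_pos_iff[of b' b] by auto
  moreover have "0 < L b' d"
    using assms L_pos_iff by blast
  ultimately show ?thesis
    using shift[of b' b d] assms by simp
qed

text \<open>Distinct points can be incomparable, hence a maximal element rather than a maximum. The
  map \<open>f\<close> allows \<open>Z\<close> to be a set of pairs compared by one
  coordinate.\<close>

lemma finite_maximal:
  assumes "finite Z" "Z \<noteq> {}" "f ` Z \<subseteq> X"
  shows "\<exists>z\<in>Z. \<forall>w\<in>Z. \<not> lt (f z) (f w)"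
  using assms
proof (induction rule: finite_ne_induct)
  case (singleton z)
  then show ?case using lt_irrefl by simp
next
  case (insert y Z)
  then obtain z where z: "z \<in> Z" "\<And>w. w \<in> Z \<Longrightarrow> \<not> lt (f z) (f w)" by auto
  have X: "f y \<in> X" "\<And>w. w \<in> Z \<Longrightarrow> f w \<in> X"
    using insert.prems by auto
  show ?case
  proof (cases "lt (f z) (f y)")
    case True
    have "\<not> lt (f y) (f w)" if "w \<in> Z" for w
      using z(2)[OF that] lt_trans[OF X(2)[OF z(1)] X(1) X(2)[OF that] True] by blast
    then show ?thesis
      using lt_irrefl[OF X(1)] by blast
  next
    case False
    then show ?thesis using z by blast
  qed
qed

end

section \<open>Partial isomorphisms and the back-and-forth construction\<close>

definition partial_iso ::
  "('a \<Rightarrow> 'a \<Rightarrow> nat) \<Rightarrow> ('a \<Rightarrow> 'a \<Rightarrow> bool) \<Rightarrow> ('b \<Rightarrow> 'b \<Rightarrow> nat) \<Rightarrow> ('b \<Rightarrow> 'b \<Rightarrow> bool) \<Rightarrow>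
    ('a \<times> 'b) set \<Rightarrow> bool" where
  "partial_iso L lt L' lt' p \<longleftrightarrow>
     (\<forall>(a, b)\<in>p. \<forall>(a', b')\<in>p. L a a' = L' b b' \<and> (lt a a' \<longleftrightarrow> lt' b b'))"

lemma partial_isoD:
  assumes "partial_iso L lt L' lt' p" "(a, b) \<in> p" "(a', b') \<in> p"
  shows "L a a' = L' b b'" "lt a a' \<longleftrightarrow> lt' b b'"
  using assms unfolding partial_iso_def by auto

lemma partial_iso_converse:
  assumes "partial_iso L lt L' lt' p"
  shows "partial_iso L' lt' L lt (p\<inverse>)"
proof -
  have "L' b b' = L a a' \<and> (lt' b b' \<longleftrightarrow> lt a a')" if "(a, b) \<in> p" "(a', b') \<in> p" for a b a' b'
    using partial_isoD[OF assms that] by simp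
  then show ?thesis
    unfolding partial_iso_def by blast
qed

text \<open>Let \<open>i\<close> be the least level from \<open>c\<close> to the domain of
  \<open>p\<close>. For \<open>i = 0\<close> a known partner is reused. Otherwise the nearest points
  lie strictly to the left or right of \<open>c\<close>, and \<open>d\<close> is found at level
  \<open>i\<close> from their partners by \<open>left\<close>, \<open>right\<close> or
  \<open>between\<close>, according to which sides are occupied.\<close>

lemma partial_iso_forth:
  assumes "level_order X lt L K" and "level_order Y lt' L' K"
    and p: "finite p" "p \<subseteq> X \<times> Y" "partial_iso L lt L' lt' p"
    and c: "c \<in> X" and "Y \<noteq> {}"
  shows "\<exists>d\<in>Y. partial_iso L lt L' lt' (insert (c, d) p)"
proof (cases "p = {}")
  case True
  interpret A: level_order X lt L K by fact
  interpret B: level_order Y lt' L' K by fact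
  obtain d where "d \<in> Y" using \<open>Y \<noteq> {}\<close> by blast
  with True show ?thesis
    using c A.L_self A.lt_irrefl B.L_self B.lt_irrefl
    unfolding partial_iso_def by (intro bexI[of _ d]) auto
next
  case False
  interpret A: level_order X lt L K by fact
  interpret B: level_order Y lt' L' K by fact
  interpret A': level_order X "\<lambda>x y. lt y x" L K by (rule A.dual)
  interpret B': level_order Y "\<lambda>x y. lt' y x" L' K by (rule B.dual)
  have in_X: "a \<in> X" and in_Y: "b \<in> Y" if "(a, b) \<in> p" for a b
    using that p(2) by auto
  define i where "i = Min ((\<lambda>(a, b). L c a) ` p)"
  have "i \<in> (\<lambda>(a, b). L c a) ` p"
    unfolding i_def using p False by (intro Min_in) auto
  then obtain a0 b0 where ab0: "(a0, b0) \<in> p" "L c a0 = i"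
    by auto
  have i_min: "i \<le> L c a" if "(a, b) \<in> p" for a b
    unfolding i_def using that p by (intro Min_le) (auto intro: image_eqI[where x = "(a, b)"])
  have "i < K"
    using A.L_less[OF c in_X[OF ab0(1)]] ab0 by simp
  \<comment> \<open>Points at level \<open>i\<close> from \<open>c\<close> are at level at most
    \<open>i\<close> from each other, and \<open>p\<close> transports this to their
    partners.\<close>
  have close: "L' b b' \<le> i" if "(a, b) \<in> p" "L c a = i" "(a', b') \<in> p" "L c a' = i" for a b a' b'
    using that partial_isoD[OF p(3) that(1,3)] A.L_ultra[of a c a'] A.L_sym[of a c] c in_X by fastforce
  \<comment> \<open>Only the pairs nearest to \<open>c\<close> constrain the image \<open>d\<close>: by \<open>shift\<close>, farther points see
    \<open>c\<close> and \<open>d\<close> as they see the nearest pair \<open>(a0, b0)\<close>.\<close>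
  define S where "S = {(a, b) \<in> p. L c a = i}"
  have S: "(a, b) \<in> S \<longleftrightarrow> (a, b) \<in> p \<and> L c a = i" for a b
    unfolding S_def by auto
  have "\<exists>d\<in>Y. \<forall>(a, b)\<in>S. L' d b = i \<and> (lt c a \<longleftrightarrow> lt' d b) \<and> (lt a c \<longleftrightarrow> lt' b d)"
  proof (cases "i = 0")
    case True
    have "L' b0 b = 0 \<and> \<not> lt c a \<and> \<not> lt a c \<and> \<not> lt' b0 b \<and> \<not> lt' b b0" if "(a, b) \<in> S" for a b
    proof -
      have "L' b0 b = 0"
        using close[of a0 b0 a b] that ab0 True S by simp
      moreover have "L c a = 0"
        using that True S by simp
      ultimately show ?thesis
        using A.L_pos_iff[OF c in_X] B.L_pos_iff[OF in_Y in_Y] ab0 that S by (metis less_irrefl)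
    qed
    \<comment> \<open>Here \<open>c\<close> is in the same class as \<open>a0\<close>. Reusing
      \<open>b0\<close> is admissible since \<open>partial_iso\<close> constrains a relation and
      does not demand injectivity.\<close>
    then show ?thesis
      using True in_Y[OF ab0(1)] by (intro bexI[of _ b0]) auto
  next
    case False
    \<comment> \<open>As \<open>i\<close> is positive, every nearest point is comparable with
      \<open>c\<close>, so \<open>Sl\<close> and \<open>Sr\<close> exhaust \<open>S\<close>.\<close>
    define Sl where "Sl = {(a, b) \<in> S. lt a c}"
    define Sr where "Sr = {(a, b) \<in> S. lt c a}"
    have Sl: "(a, b) \<in> Sl \<longleftrightarrow> (a, b) \<in> p \<and> L c a = i \<and> lt a c" for a b
      unfolding Sl_def S_def by auto
    have Sr: "(a, b) \<in> Sr \<longleftrightarrow> (a, b) \<in> p \<and> L c a = i \<and> lt c a" for a b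
      unfolding Sr_def S_def by auto
    have fin: "finite Sl" "finite Sr"
      using p(1) unfolding Sl_def Sr_def S_def by (auto intro: finite_subset)
    have sub: "Sl \<subseteq> p" "Sr \<subseteq> p"
      unfolding Sl_def Sr_def S_def by auto
    have maxl: "\<exists>(a1, b1)\<in>Sl. \<forall>(a, b)\<in>Sl. \<not> lt a1 a" if "Sl \<noteq> {}"
      using A.finite_maximal[OF fin(1) that, of fst] sub(1) p(2) by fastforce
    have minr: "\<exists>(a2, b2)\<in>Sr. \<forall>(a, b)\<in>Sr. \<not> lt a a2" if "Sr \<noteq> {}"
      using A'.finite_maximal[OF fin(2) that, of fst] sub(2) p(2) by fastforce
    have below: "lt' b d \<and> L' b d = i"
      if "(a1, b1) \<in> Sl" "\<forall>(a, b)\<in>Sl. \<not> lt a1 a" "d \<in> Y" "lt' b1 d" "L' b1 d = i" "(a, b) \<in> Sl"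
      for a1 b1 a b d
    proof -
      have ab: "(a, b) \<in> p" "(a1, b1) \<in> p" "L' b b1 \<le> i"
        using that(1,6) close[of a b a1 b1] unfolding Sl by simp_all
      have "\<not> lt' b1 b"
        using that(2,6) partial_isoD(2)[OF p(3) ab(2,1)] by blast
      then show ?thesis
        using B.beyond_right[OF in_Y[OF ab(1)] in_Y[OF ab(2)] that(3,4)] ab(3) that(5) by simp
    qed
    have above: "lt' d b \<and> L' d b = i"
      if "(a2, b2) \<in> Sr" "\<forall>(a, b)\<in>Sr. \<not> lt a a2" "d \<in> Y" "lt' d b2" "L' b2 d = i" "(a, b) \<in> Sr"
      for a2 b2 a b d
    proof -
      have ab: "(a, b) \<in> p" "(a2, b2) \<in> p" "L' b b2 \<le> i"
        using that(1,6) close[of a b a2 b2] unfolding Sr by simp_all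
      have "\<not> lt' b b2"
        using that(2,6) partial_isoD(2)[OF p(3) ab(1,2)] by blast
      then show ?thesis
        using B'.beyond_right[OF in_Y[OF ab(1)] in_Y[OF ab(2)] that(3,4)] ab(3) that(5)
          B.L_sym[of d b] by simp
    qed
    have "\<exists>d\<in>Y. (\<forall>(a, b)\<in>Sl. lt' b d \<and> L' b d = i) \<and> (\<forall>(a, b)\<in>Sr. lt' d b \<and> L' d b = i)"
    proof (cases "Sl = {}")
      case Sl_empty: True
      have "Sr \<noteq> {}"
        using ab0 A.L_pos_iff[OF c in_X[OF ab0(1)]] False Sl_empty Sl Sr by auto
      then obtain a2 b2 where ab2: "(a2, b2) \<in> Sr" "\<forall>(a, b)\<in>Sr. \<not> lt a a2"
        using minr by blast
      then obtain d where "d \<in> Y" "lt' d b2" "L' b2 d = i"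
        using B.left[of b2 i] in_Y False \<open>i < K\<close> Sr by blast
      then show ?thesis
        using above[OF ab2] Sl_empty by (intro bexI[of _ d]) auto
    next
      case Sl_nonempty: False
      then obtain a1 b1 where ab1: "(a1, b1) \<in> Sl" "\<forall>(a, b)\<in>Sl. \<not> lt a1 a"
        using maxl by blast
      show ?thesis
      proof (cases "Sr = {}")
        case Sr_empty: True
        obtain d where "d \<in> Y" "lt' b1 d" "L' b1 d = i"
          using B.right[of b1 i] in_Y False \<open>i < K\<close> Sl ab1 by blast
        then show ?thesis
          using below[OF ab1] Sr_empty by (intro bexI[of _ d]) auto
      next
        case Sr_nonempty: False
        then obtain a2 b2 where ab2: "(a2, b2) \<in> Sr" "\<forall>(a, b)\<in>Sr. \<not> lt a a2"
          using minr by blast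
        have *: "(a1, b1) \<in> p" "(a2, b2) \<in> p" "L c a1 = i" "L c a2 = i" "lt a1 c" "lt c a2"
          using ab1 ab2 Sl Sr by auto
        \<comment> \<open>Convexity around \<open>c\<close> gives level at least \<open>i\<close>,
          and \<open>close\<close> gives at most \<open>i\<close> for the partners. Thus
          \<open>between\<close> yields a point at exactly level \<open>i\<close> from both ends of
          the gap.\<close>
        have "lt a1 a2" "i \<le> L a1 a2"
          using A.lt_trans[of a1 c a2] A.lt_convex[of a1 c a2] * in_X c by auto
        then have b12: "lt' b1 b2" "L' b1 b2 = i"
          using partial_isoD[OF p(3) *(1,2)] close[OF *(1,3,2,4)] by auto
        then obtain d where "d \<in> Y" "lt' b1 d" "lt' d b2" "L' b1 d = i" "L' d b2 = i"
          using B.between[of b1 b2] in_Y * by metis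
        then show ?thesis
          using below[OF ab1, of d] above[OF ab2, of d] B.L_sym[of d b2] by (intro bexI[of _ d]) auto
      qed
    qed
    then obtain d where d: "d \<in> Y" "\<And>a b. (a, b) \<in> Sl \<Longrightarrow> lt' b d \<and> L' b d = i"
        "\<And>a b. (a, b) \<in> Sr \<Longrightarrow> lt' d b \<and> L' d b = i"
      by blast
    have "L' d b = i \<and> (lt c a \<longleftrightarrow> lt' d b) \<and> (lt a c \<longleftrightarrow> lt' b d)" if "(a, b) \<in> S" for a b
    proof -
      have ab: "(a, b) \<in> p" "L c a = i"
        using that S by auto
      then consider "(a, b) \<in> Sl" | "(a, b) \<in> Sr"
        using A.L_pos_iff[OF c in_X[OF ab(1)]] False Sl Sr by auto
      then show ?thesis
      proof cases
        case 1
        then show ?thesis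
          using d(1) d(2)[OF 1] ab Sl A.lt_asym B.lt_asym B.L_sym[of b d] c in_X in_Y by metis
      next
        case 2
        then show ?thesis
          using d(1) d(3)[OF 2] ab Sr A.lt_asym B.lt_asym c in_X in_Y by metis
      qed
    qed
    then show ?thesis
      using d(1) by blast
  qed
  then obtain d where d: "d \<in> Y"
    "\<And>a b. (a, b) \<in> S \<Longrightarrow> L' d b = i \<and> (lt c a \<longleftrightarrow> lt' d b) \<and> (lt a c \<longleftrightarrow> lt' b d)"
    by blast
  have all: "L c a = L' d b \<and> (lt c a \<longleftrightarrow> lt' d b) \<and> (lt a c \<longleftrightarrow> lt' b d)" if ab: "(a, b) \<in> p" for a b
  proof (cases "L c a = i")
    case True
    then show ?thesis using d(2)[of a b] S ab by simp
  next
    case False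
    then have far: "L c a0 < L c a"
      using i_min[OF ab] ab0 by simp
    note sA = A.shift[OF c in_X[OF ab0(1)] in_X[OF ab] far]
    have "L' b0 d = i"
      using d(2)[of a0 b0] ab0 S B.L_sym[of b0 d] by simp
    then have "L' b0 d < L' b0 b"
      using partial_isoD(1)[OF p(3) ab0(1) ab] sA far ab0 by simp
    note sB = B.shift[OF in_Y[OF ab0(1)] d(1) in_Y[OF ab] this]
    show ?thesis
      using sA sB partial_isoD[OF p(3) ab0(1) ab] partial_isoD[OF p(3) ab ab0(1)] by simp
  qed
  have "L a a' = L' b b' \<and> (lt a a' \<longleftrightarrow> lt' b b')"
    if ins: "(a, b) \<in> insert (c, d) p" "(a', b') \<in> insert (c, d) p" for a b a' b'
  proof -
    consider "(a, b) \<in> p" "(a', b') \<in> p" | "(a, b) \<in> p" "a' = c" "b' = d"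
      | "a = c" "b = d" "(a', b') \<in> p" | "a = c" "b = d" "a' = c" "b' = d"
      using ins by blast
    then show ?thesis
    proof cases
      case 1
      then show ?thesis using partial_isoD[OF p(3)] by blast
    next
      case 2
      then show ?thesis using all[of a b] A.L_sym[of a c] B.L_sym[of b d] by simp
    next
      case 3
      then show ?thesis using all[of a' b'] by simp
    next
      case 4
      then show ?thesis
        using A.L_self[OF c] B.L_self[OF d(1)] A.lt_irrefl[OF c] B.lt_irrefl[OF d(1)] by simp
    qed
  qed
  then have "partial_iso L lt L' lt' (insert (c, d) p)"
    unfolding partial_iso_def by blast
  with d(1) show ?thesis by blast
qed

lemma partial_iso_back:
  assumes "level_order X lt L K" and "level_order Y lt' L' K"
    and p: "finite p" "p \<subseteq> X \<times> Y" "partial_iso L lt L' lt' p"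
    and d: "d \<in> Y" and "X \<noteq> {}"
  shows "\<exists>c\<in>X. partial_iso L lt L' lt' (insert (c, d) p)"
proof -
  obtain c where c: "c \<in> X" and iso: "partial_iso L' lt' L lt (insert (d, c) (p\<inverse>))"
    using partial_iso_forth[OF assms(2,1) _ _ partial_iso_converse[OF p(3)] d \<open>X \<noteq> {}\<close>] p(1,2)
    by auto
  have "(insert (d, c) (p\<inverse>))\<inverse> = insert (c, d) p" by auto
  with c partial_iso_converse[OF iso] show ?thesis by auto
qed

text \<open>Only the countable sets \<open>A\<close> and \<open>B\<close> have to be covered, so
  countably many finite stages suffice. The possibly uncountable remainder of \<open>X\<close> and
  \<open>Y\<close> is left to \<open>congruence\<close>.\<close>

lemma back_and_forth:
  assumes X: "level_order X lt L K" and Y: "level_order Y lt' L' K"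
    and A: "countable A" "A \<subseteq> X" "A \<noteq> {}" and B: "countable B" "B \<subseteq> Y" "B \<noteq> {}"
  shows "\<exists>P \<subseteq> X \<times> Y. partial_iso L lt L' lt' P \<and> A \<subseteq> Domain P \<and> B \<subseteq> Range P"
proof -
  let ?good = "\<lambda>p. finite p \<and> p \<subseteq> X \<times> Y \<and> partial_iso L lt L' lt' p"
  have ne: "X \<noteq> {}" "Y \<noteq> {}" using A(2,3) B(2,3) by blast+
  \<comment> \<open>Stage \<open>n\<close> adds a partner for the \<open>n\<close>-th element of
    \<open>A\<close> and then one for the \<open>n\<close>-th element of \<open>B\<close>.
    Repetitions in the enumerations do no harm.\<close>
  have "\<exists>f. \<forall>n. ?good (f n) \<and> (f n \<subseteq> f (Suc n) \<and> from_nat_into A n \<in> Domain (f (Suc n)) \<and>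
      from_nat_into B n \<in> Range (f (Suc n)))"
  proof (rule dependent_nat_choice)
    show "\<exists>p. ?good p"
      by (rule exI[of _ "{}"]) (simp add: partial_iso_def)
  next
    fix p n assume p: "?good p"
    have a: "from_nat_into A n \<in> X" and b: "from_nat_into B n \<in> Y"
      using from_nat_into[of A n] from_nat_into[of B n] A B by auto
    obtain d where d: "d \<in> Y" "partial_iso L lt L' lt' (insert (from_nat_into A n, d) p)"
      using partial_iso_forth[OF X Y _ _ _ a ne(2)] p by blast
    then obtain c where "c \<in> X"
      "partial_iso L lt L' lt' (insert (c, from_nat_into B n) (insert (from_nat_into A n, d) p))"
      using partial_iso_back[OF X Y _ _ d(2) b ne(1)] p a by auto
    then show "\<exists>q. ?good q \<and> (p \<subseteq> q \<and> from_nat_into A n \<in> Domain q \<and> from_nat_into B n \<in> Range q)"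
      using p a b d(1)
      by (intro exI[of _ "insert (c, from_nat_into B n) (insert (from_nat_into A n, d) p)"]) auto
  qed
  then obtain f where f: "\<And>n. ?good (f n)" "\<And>n. f n \<subseteq> f (Suc n)"
    "\<And>n. from_nat_into A n \<in> Domain (f (Suc n))" "\<And>n. from_nat_into B n \<in> Range (f (Suc n))"
    by blast
  have mono: "f m \<subseteq> f n" if "m \<le> n" for m n
    by (rule lift_Suc_mono_le[of f, OF f(2) that])
  \<comment> \<open>Being a partial isomorphism is a condition on two pairs, and any two pairs of
    the union lie in a common stage.\<close>
  have "partial_iso L lt L' lt' (\<Union>n. f n)"
    unfolding partial_iso_def
  proof clarify
    fix a b a' b' m n assume "(a, b) \<in> f m" "(a', b') \<in> f n"
    then have "(a, b) \<in> f (max m n)" "(a', b') \<in> f (max m n)"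
      using mono[of m "max m n"] mono[of n "max m n"] by auto
    moreover have "partial_iso L lt L' lt' (f (max m n))"
      using f(1) by blast
    ultimately show "L a a' = L' b b' \<and> (lt a a' \<longleftrightarrow> lt' b b')"
      using partial_isoD[of L lt L' lt' "f (max m n)" a b a' b'] by blast
  qed
  moreover have "A \<subseteq> Domain (\<Union>n. f n)"
  proof
    fix a assume "a \<in> A"
    then obtain n where "a = from_nat_into A n"
      using from_nat_into_surj[OF A(1)] by metis
    then show "a \<in> Domain (\<Union>n. f n)" using f(3)[of n] by auto
  qed
  moreover have "B \<subseteq> Range (\<Union>n. f n)"
  proof
    fix b assume "b \<in> B"
    then obtain n where "b = from_nat_into B n"
      using from_nat_into_surj[OF B(1)] by metis
    then show "b \<in> Range (\<Union>n. f n)" using f(4)[of n] by auto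
  qed
  moreover have "(\<Union>n. f n) \<subseteq> X \<times> Y" using f(1) by blast
  ultimately show ?thesis by blast
qed

section \<open>Models of \<open>UDLO\<close>\<close>

text \<open>
  The levels cut \<open>{0..1}\<close> into \<open>{0..1/K}\<close> (level 0) and \<open>{i/K<..(i+1)/K}\<close> (level \<open>i\<close>); at
  distance 0 the \<open>nat\<close> truncates \<open>-1\<close> to 0.
\<close>

definition level :: "nat \<Rightarrow> 'u ordered_metric \<Rightarrow> 'u \<Rightarrow> 'u \<Rightarrow> nat" where
  "level K M x y = nat (\<lceil>real K * dst M x y\<rceil> - 1)"

text \<open>Positivity of the level discards the order inside classes of level 0, which a
  correlation need not respect.\<close>

definition level_less :: "nat \<Rightarrow> 'u ordered_metric \<Rightarrow> 'u \<Rightarrow> 'u \<Rightarrow> bool" where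
  "level_less K M x y \<longleftrightarrow> (x, y) \<in> ord M \<and> 0 < level K M x y"

lemma level_le_iff: "level K M x y \<le> i \<longleftrightarrow> real K * dst M x y \<le> real i + 1"
proof -
  have "level K M x y \<le> i \<longleftrightarrow> \<lceil>real K * dst M x y\<rceil> \<le> int i + 1"
    unfolding level_def by auto
  also have "\<dots> \<longleftrightarrow> real K * dst M x y \<le> real i + 1"
    by (simp add: ceiling_le_iff)
  finally show ?thesis .
qed

lemma level_mono: "dst M x y \<le> dst N x' y' \<Longrightarrow> level K M x y \<le> level K N x' y'"
  unfolding level_def by (intro nat_mono diff_mono ceiling_mono mult_left_mono) auto

lemma level_eqI:
  assumes "real i < real K * dst M x y" "real K * dst M x y \<le> real i + 1"
  shows "level K M x y = i"
proof -
  have "level K M x y \<le> i"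
    using assms by (simp add: level_le_iff)
  \<comment> \<open>For \<open>i = 0\<close> the upper bound already determines the level; the
    restriction to positive \<open>i\<close> avoids truncated subtraction.\<close>
  moreover have "\<not> level K M x y \<le> i - 1" if "0 < i"
    using assms that by (simp add: level_le_iff of_nat_diff)
  ultimately show ?thesis by fastforce
qed

text \<open>The strict lower bound is restricted to positive levels because distance 0 has level
  0.\<close>

lemma level_bounds:
  "real K * dst M x y \<le> real (level K M x y) + 1"
  "0 < level K M x y \<Longrightarrow> real (level K M x y) < real K * dst M x y"
proof -
  show "real K * dst M x y \<le> real (level K M x y) + 1"
    using level_le_iff[of K M x y "level K M x y"] by simp
  show "real (level K M x y) < real K * dst M x y" if "0 < level K M x y"
  proof -
    have "\<not> level K M x y \<le> level K M x y - 1"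
      using that by linarith
    then have "\<not> real K * dst M x y \<le> real (level K M x y - 1) + 1"
      unfolding level_le_iff .
    with that show ?thesis by (simp add: of_nat_diff)
  qed
qed

lemma dst_diff_le_of_level_eq:
  assumes "0 < K" "level K M x y = level K N x' y'"
  shows "\<bar>dst M x y - dst N x' y'\<bar> \<le> 1 / real K"
proof -
  have "real K * dst M x y \<ge> 0" "real K * dst N x' y' \<ge> 0" by simp_all
  moreover have "real (level K M x y) = real (level K N x' y')"
    using assms(2) by simp
  ultimately have "\<bar>real K * dst M x y - real K * dst N x' y'\<bar> \<le> 1"
    using level_bounds[of K M x y] level_bounds[of K N x' y'] assms(2)
    by linarith
  then have "real K * \<bar>dst M x y - dst N x' y'\<bar> \<le> 1"
    by (simp add: abs_mult flip: right_diff_distrib)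
  then show ?thesis
    using assms(1) by (simp add: field_simps)
qed

lemma dense_real_set:
  fixes D :: "real set"
  assumes "{0..1} \<subseteq> closure D" "0 \<le> s" "s < t" "t \<le> 1"
  shows "\<exists>v\<in>D. s < v \<and> v < t"
proof -
  have "(s + t) / 2 \<in> closure D"
    using assms by (auto intro!: subsetD[OF assms(1)])
  then obtain v where "v \<in> D" "dist v ((s + t) / 2) < (t - s) / 2"
    using assms(3) unfolding closure_approachable by (meson diff_gt_0_iff_gt half_gt_zero)
  then show ?thesis
    by (intro bexI[of _ v]) (auto simp: dist_real_def abs_less_iff field_simps)
qed

section \<open>Order and metric in a single model\<close>

locale UDLO_model =
  fixes M :: "'u ordered_metric"
  assumes UDLO: "M \<in> UDLO"
begin

lemma ultrametric:
  "x \<in> pts M \<Longrightarrow> y \<in> pts M \<Longrightarrow> z \<in> pts M \<Longrightarrow> dst M x z \<le> max (dst M x y) (dst M y z)"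
  using UDLO unfolding UDLO_def by blast

lemma dst_le_1: "x \<in> pts M \<Longrightarrow> y \<in> pts M \<Longrightarrow> dst M x y \<le> 1"
  using UDLO unfolding UDLO_def by blast

lemma pts_nonempty: "pts M \<noteq> {}"
  using UDLO unfolding UDLO_def by blast

lemma linear_order: "linear_order_on (pts M) (ord M)"
  using UDLO unfolding UDLO_def metric_linear_order_def by blast

lemma ord_pts: "(x, y) \<in> ord M \<Longrightarrow> x \<in> pts M \<and> y \<in> pts M"
  using linear_order unfolding linear_order_on_def partial_order_on_def preorder_on_def by blast

lemma ord_refl: "x \<in> pts M \<Longrightarrow> (x, x) \<in> ord M"
  using linear_order unfolding linear_order_on_def partial_order_on_def preorder_on_def refl_on_def
  by blast

lemma ord_antisym: "(x, y) \<in> ord M \<Longrightarrow> (y, x) \<in> ord M \<Longrightarrow> x = y"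
  using linear_order unfolding linear_order_on_def partial_order_on_def antisym_def by blast

lemma ord_trans: "(x, y) \<in> ord M \<Longrightarrow> (y, z) \<in> ord M \<Longrightarrow> (x, z) \<in> ord M"
  using linear_order unfolding linear_order_on_def partial_order_on_def preorder_on_def
  by (blast dest: transD)

lemma ord_total: "x \<in> pts M \<Longrightarrow> y \<in> pts M \<Longrightarrow> (x, y) \<in> ord M \<or> (y, x) \<in> ord M"
  using linear_order ord_refl[of x] unfolding linear_order_on_def total_on_def
  by (cases "x = y") auto

lemma ball_convex:
  assumes "c \<in> pts M" "dst M c x < r" "dst M c z < r" "(x, y) \<in> ord M" "(y, z) \<in> ord M"
  shows "dst M c y < r"
proof -
  have "0 < r"
    using assms(2) mdist_nonneg[of "met M" c x] by linarith
  then have "order_convex M (mball_of (met M) c r)"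
    using UDLO assms(1) unfolding UDLO_def metric_linear_order_def by blast
  then have "y \<in> mball_of (met M) c r"
    using assms ord_pts unfolding order_convex_def by (meson in_mball_of)
  then show ?thesis by simp
qed

text \<open>Every ball around one endpoint with radius above \<open>dst M x z\<close> contains both
  endpoints, hence \<open>y\<close> by convexity. Letting the radius decrease gives the
  bounds.\<close>

lemma dst_convex:
  assumes "(x, y) \<in> ord M" "(y, z) \<in> ord M"
  shows "dst M x y \<le> dst M x z" "dst M y z \<le> dst M x z"
proof -
  have pts: "x \<in> pts M" "y \<in> pts M" "z \<in> pts M"
    using assms ord_pts by blast+
  have self: "dst M x x = 0" "dst M z z = 0"
    using pts by simp_all
  show "dst M x y \<le> dst M x z"
  proof (rule dense_ge)
    fix r assume "dst M x z < r"
    then show "dst M x y \<le> r"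
      using ball_convex[of x x r z y] pts assms self mdist_nonneg[of "met M" x z] by linarith
  qed
  show "dst M y z \<le> dst M x z"
  proof (rule dense_ge)
    fix r assume "dst M x z < r"
    then show "dst M y z \<le> r"
      using ball_convex[of z x r z y] pts assms self mdist_nonneg[of "met M" x z]
        mdist_commute[of "met M" z x] mdist_commute[of "met M" z y] by linarith
  qed
qed

text \<open>Either \<open>x\<close> itself lies on the ray, or, by \<open>dst_convex\<close>, the
  endpoint \<open>y\<close> is the point of the ray nearest to \<open>x\<close>. In both cases the
  infimum is attained.\<close>

lemma ray_dist_eq:
  assumes "x \<in> pts M" "y \<in> pts M"
  shows "ray_dist M x y = (if (x, y) \<in> ord M then 0 else dst M x y)"
proof (cases "(x, y) \<in> ord M")
  case True
  have "dst M x x = 0"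
    using assms by simp
  with True have "0 \<in> {dst M x z | z. (z, y) \<in> ord M}"
    by force
  then have "ray_dist M x y = 0"
    unfolding ray_dist_def by (rule cInf_eq_minimum) auto
  with True show ?thesis by simp
next
  case False
  then have yx: "(y, x) \<in> ord M"
    using ord_total assms by blast
  have "dst M x y \<le> dst M x z" if "(z, y) \<in> ord M" for z
    using dst_convex(2)[OF that yx] mdist_commute[of "met M"] by metis
  then have "ray_dist M x y = dst M x y"
    unfolding ray_dist_def using ord_refl[OF assms(2)] by (intro cInf_eq_minimum) auto
  with False show ?thesis by simp
qed

lemma dense_above:
  assumes "a \<in> pts M" "0 \<le> s" "s < t" "t \<le> 1"
  shows "\<exists>b. (a, b) \<in> ord M \<and> s < dst M a b \<and> dst M a b < t"
proof -
  have "{0..1} \<subseteq> closure {dst M a b | b. (a, b) \<in> ord M \<and> b \<noteq> a}"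
    using UDLO assms(1) unfolding UDLO_def by blast
  from dense_real_set[OF this assms(2-4)] show ?thesis by blast
qed

lemma dense_below:
  assumes "a \<in> pts M" "0 \<le> s" "s < t" "t \<le> 1"
  shows "\<exists>b. (b, a) \<in> ord M \<and> s < dst M a b \<and> dst M a b < t"
proof -
  have "{0..1} \<subseteq> closure {dst M a b | b. (b, a) \<in> ord M \<and> b \<noteq> a}"
    using UDLO assms(1) unfolding UDLO_def by blast
  from dense_real_set[OF this assms(2-4)] show ?thesis by blast
qed

text \<open>Since \<open>level\<close> is monotone in the distance, the ultrametric inequality and
  convexity descend to levels. The existence axioms \<open>right\<close>, \<open>left\<close> and
  \<open>between\<close> come from density of the distances on each side of a point.\<close>

lemma level_order:
  assumes K: "0 < K"
  shows "level_order (pts M) (level_less K M) (level K M) K"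
proof
  fix x assume "x \<in> pts M"
  then have "dst M x x = 0" by simp
  then show "level K M x x = 0" by (simp add: level_def)
next
  fix x y
  show "level K M x y = level K M y x"
    by (simp add: level_def mdist_commute)
next
  fix x y z assume "x \<in> pts M" "y \<in> pts M" "z \<in> pts M"
  then have "dst M x z \<le> dst M x y \<or> dst M x z \<le> dst M y z"
    using ultrametric[of x y z] by linarith
  then have "level K M x z \<le> level K M x y \<or> level K M x z \<le> level K M y z"
    using level_mono by metis
  then show "level K M x z \<le> max (level K M x y) (level K M y z)"
    by linarith
next
  fix x y assume "x \<in> pts M" "y \<in> pts M"
  then have "real K * dst M x y \<le> real K"
    using dst_le_1[of x y] by (simp add: mult_left_le)
  then have "level K M x y \<le> K - 1"
    using K by (simp add: level_le_iff of_nat_diff)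
  with K show "level K M x y < K" by linarith
next
  fix x y assume "x \<in> pts M" "y \<in> pts M"
  moreover have "level K M y x = level K M x y"
    by (simp add: level_def mdist_commute)
  ultimately show "0 < level K M x y \<longleftrightarrow> level_less K M x y \<or> level_less K M y x"
    using ord_total[of x y] unfolding level_less_def by auto
next
  fix x y assume xy: "x \<in> pts M" "level_less K M x y"
  show "\<not> level_less K M y x"
  proof
    assume "level_less K M y x"
    then have "x = y" using xy ord_antisym unfolding level_less_def by blast
    then have "dst M x y = 0" using xy by simp
    then show False using xy by (simp add: level_less_def level_def)
  qed
next
  fix x y z assume "level_less K M x y" "level_less K M y z"
  then have *: "(x, y) \<in> ord M" "(y, z) \<in> ord M" "0 < level K M x y"
    unfolding level_less_def by auto
  have le: "level K M x y \<le> level K M x z" "level K M y z \<le> level K M x z"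
    by (intro level_mono dst_convex[OF *(1,2)])+
  then show "level_less K M x z" "level K M x y \<le> level K M x z \<and> level K M y z \<le> level K M x z"
    using * ord_trans unfolding level_less_def by (blast intro: less_le_trans)+
next
  fix x i assume x: "x \<in> pts M" and i: "0 < i" "i < K"
  \<comment> \<open>The open interval from \<open>i / K\<close> to \<open>(i + 1) / K\<close> lies
    inside the unit interval and contains only distances of level \<open>i\<close>.\<close>
  have st: "0 \<le> real i / real K" "real i / real K < (real i + 1) / real K" "(real i + 1) / real K \<le> 1"
    using i by (auto simp: field_simps)
  have lev: "level K M x y = i" if "real i / real K < dst M x y" "dst M x y < (real i + 1) / real K" for y
    using that i by (intro level_eqI) (auto simp: field_simps)
  show "\<exists>y\<in>pts M. level_less K M x y \<and> level K M x y = i"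
    using dense_above[OF x st] lev i(1) ord_pts unfolding level_less_def by metis
  have "level K M y x = level K M x y" for y
    by (simp add: level_def mdist_commute)
  then show "\<exists>y\<in>pts M. level_less K M y x \<and> level K M x y = i"
    using dense_below[OF x st] lev i(1) ord_pts unfolding level_less_def by metis
next
  fix x y assume xy: "x \<in> pts M" "y \<in> pts M" "level_less K M x y"
  define i where "i = level K M x y"
  have i: "0 < i" "(x, y) \<in> ord M" "real i < real K * dst M x y" "real K * dst M x y \<le> real i + 1"
    using xy level_bounds[of K M x y] unfolding level_less_def i_def by auto
  have "real i / real K < dst M x y"
    using i K by (simp add: field_simps)
  \<comment> \<open>Since positive levels are intervals open at the left, there is room below
    \<open>dst M x y\<close> within level \<open>i\<close>. A point \<open>z\<close> above
    \<open>x\<close> at such a smaller distance must precede \<open>y\<close> by convexity, and the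
    isosceles property then gives \<open>z\<close> and \<open>y\<close> the same distance as
    \<open>x\<close> and \<open>y\<close>.\<close>
  then obtain z where z: "(x, z) \<in> ord M" "real i / real K < dst M x z" "dst M x z < dst M x y"
    using dense_above[OF xy(1), of "real i / real K" "dst M x y"] dst_le_1[OF xy(1,2)] by auto
  have zM: "z \<in> pts M" using z ord_pts by blast
  have zy: "(z, y) \<in> ord M"
    using ord_total[OF zM xy(2)] dst_convex(1)[OF i(2), of z] z(3) by fastforce
  have "dst M z y = dst M x y"
    using ultrametric[OF xy(1) zM xy(2)] dst_convex(2)[OF z(1) zy] z(3) by linarith
  then have "level K M z y = i" unfolding i_def level_def by simp
  moreover have "real i < real K * dst M x z"
    using z(2) K by (simp add: field_simps)
  moreover have "real K * dst M x z \<le> real i + 1"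
    using mult_left_mono[of "dst M x z" "dst M x y" "real K"] z(3) i(4) by linarith
  ultimately show "\<exists>z\<in>pts M. level_less K M x z \<and> level_less K M z y \<and>
      level K M x z = level K M x y \<and> level K M z y = level K M x y"
    using zM zy z(1) i(1) level_eqI[of i K M x z] unfolding level_less_def i_def by auto
qed

lemma separable_dense:
  assumes "separable M"
  shows "\<exists>A. countable A \<and> A \<subseteq> pts M \<and> A \<noteq> {} \<and> (\<forall>x\<in>pts M. \<forall>r>0. \<exists>a\<in>A. dst M x a < r)"
proof -
  interpret MS: Metric_space "pts M" "dst M" by (rule Metric_space_mspace_mdist)
  obtain A where A: "countable A" "A \<subseteq> pts M" "mtopology_of (met M) closure_of A = pts M"
    using assms unfolding separable_space_def by auto
  have "\<exists>a\<in>A. dst M x a < r" if "x \<in> pts M" "r > 0" for x r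
  proof -
    have "x \<in> MS.mtopology closure_of A"
      using A(3) that(1) unfolding mtopology_of_def by simp
    then show ?thesis
      using that(2) unfolding MS.metric_closure_of by auto
  qed
  moreover from this have "A \<noteq> {}"
    using pts_nonempty zero_less_one by blast
  ultimately show ?thesis using A by blast
qed

end

section \<open>Correlations between two separable models\<close>

lemma OGH_bounded:
  assumes "\<phi> \<in> OGH"
  shows "\<exists>C. \<forall>(M, e)\<in>valuations (UDLO :: 'u ordered_metric set). \<bar>eval \<phi> M e\<bar> \<le> C"
proof -
  have "\<bar>eval \<phi> M e\<bar> \<le> 1" if "(M, e) \<in> valuations UDLO" for M :: "'u ordered_metric" and e
  proof -
    interpret UDLO_model M using valuationsD(1)[OF that] by unfold_locales
    have "e 0 \<in> pts M" "e 1 \<in> pts M" using valuationsD(2)[OF that] by auto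
    then show ?thesis
      using assms dst_le_1[of "e 0" "e 1"] ray_dist_eq[of "e 0" "e 1"] unfolding OGH_def by auto
  qed
  then show ?thesis by blast
qed

text \<open>Back and forth matches countable dense sets exactly. Every point is within
  \<open>1 / K\<close> of its dense set, so thickening the matching by level 0 in both coordinates
  reaches all points, and \<open>congruence\<close> shows that levels and strict order are still
  preserved exactly.\<close>

lemma UDLO_correlation:
  fixes M N :: "'u ordered_metric"
  assumes "M \<in> UDLO" "N \<in> UDLO" "separable M" "separable N" and K: "0 < K"
  shows "\<exists>R. correlation M N R \<and>
    (\<forall>(m, n)\<in>R. \<forall>(m', n')\<in>R. level K M m m' = level K N n n' \<and>
      (level_less K M m m' \<longleftrightarrow> level_less K N n n'))"
proof -
  interpret M: UDLO_model M by unfold_locales fact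
  interpret N: UDLO_model N by unfold_locales fact
  interpret LM: level_order "pts M" "level_less K M" "level K M" K by (rule M.level_order[OF K])
  interpret LN: level_order "pts N" "level_less K N" "level K N" K by (rule N.level_order[OF K])
  obtain A where A: "countable A" "A \<subseteq> pts M" "A \<noteq> {}"
      "\<And>x r. x \<in> pts M \<Longrightarrow> r > 0 \<Longrightarrow> \<exists>a\<in>A. dst M x a < r"
    using M.separable_dense[OF assms(3)] by metis
  obtain B where B: "countable B" "B \<subseteq> pts N" "B \<noteq> {}"
      "\<And>x r. x \<in> pts N \<Longrightarrow> r > 0 \<Longrightarrow> \<exists>b\<in>B. dst N x b < r"
    using N.separable_dense[OF assms(4)] by metis
  obtain P where P: "P \<subseteq> pts M \<times> pts N" "A \<subseteq> Domain P" "B \<subseteq> Range P"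
    and iso: "partial_iso (level K M) (level_less K M) (level K N) (level_less K N) P"
    using back_and_forth[OF M.level_order[OF K] N.level_order[OF K] A(1-3) B(1-3)] by metis
  have lev0: "level K Q x a = 0" if "dst Q x a < 1 / real K" for Q :: "'u ordered_metric" and x a
    using that K level_le_iff[of K Q x a 0] by (simp add: field_simps)
  have nearM: "\<exists>(a, b)\<in>P. level K M m a = 0" if "m \<in> pts M" for m
    using A(4)[OF that, of "1 / real K"] K lev0 P(2) by fastforce
  have nearN: "\<exists>(a, b)\<in>P. level K N n b = 0" if "n \<in> pts N" for n
    using B(4)[OF that, of "1 / real K"] K lev0 P(3) by fastforce
  define R where "R = {(m, n) \<in> pts M \<times> pts N. \<exists>(a, b)\<in>P. level K M m a = 0 \<and> level K N n b = 0}"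
  have "correlation M N R"
    unfolding correlation_def
  proof (intro conjI ballI)
    show "R \<subseteq> pts M \<times> pts N" unfolding R_def by auto
    show "\<exists>n. (m, n) \<in> R" if m: "m \<in> pts M" for m
    proof -
      obtain a b where ab: "(a, b) \<in> P" "level K M m a = 0" using nearM[OF m] by blast
      moreover have "b \<in> pts N" using ab P by auto
      moreover from this have "level K N b b = 0" by (rule LN.L_self)
      ultimately show ?thesis using m unfolding R_def by blast
    qed
    show "\<exists>m. (m, n) \<in> R" if n: "n \<in> pts N" for n
    proof -
      obtain a b where ab: "(a, b) \<in> P" "level K N n b = 0" using nearN[OF n] by blast
      moreover have "a \<in> pts M" using ab P by auto
      moreover from this have "level K M a a = 0" by (rule LM.L_self)
      ultimately show ?thesis using n unfolding R_def by blast
    qed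
  qed
  moreover have "level K M m m' = level K N n n' \<and> (level_less K M m m' \<longleftrightarrow> level_less K N n n')"
    if mn: "(m, n) \<in> R" "(m', n') \<in> R" for m n m' n'
  proof -
    obtain a b where ab: "(a, b) \<in> P" "level K M m a = 0" "level K N n b = 0"
      using mn(1) unfolding R_def by blast
    obtain a' b' where ab': "(a', b') \<in> P" "level K M m' a' = 0" "level K N n' b' = 0"
      using mn(2) unfolding R_def by blast
    have "m \<in> pts M" "m' \<in> pts M" "a \<in> pts M" "a' \<in> pts M"
      "n \<in> pts N" "n' \<in> pts N" "b \<in> pts N" "b' \<in> pts N"
      using mn ab(1) ab'(1) P(1) unfolding R_def by auto
    then show ?thesis
      using LM.congruence[of m m' a a'] LN.congruence[of n n' b b'] ab ab'
        partial_isoD[OF iso ab(1) ab'(1)] by simp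
  qed
  ultimately show ?thesis
    by (intro exI[of _ R]) blast
qed

lemma UDLO_distortion:
  fixes M N :: "'u ordered_metric"
  assumes "M \<in> UDLO" "N \<in> UDLO" "separable M" "separable N" and \<epsilon>: "(0::real) < \<epsilon>"
  shows "\<exists>R. correlation M N R \<and> distortion (fm_closure (UDLO :: 'u ordered_metric set) OGH) M N R \<le> ereal \<epsilon>"
proof -
  interpret M: UDLO_model M by unfold_locales fact
  interpret N: UDLO_model N by unfold_locales fact
  obtain K' where "inverse (real (Suc K')) < \<epsilon>"
    using reals_Archimedean[OF \<epsilon>] by blast
  then obtain K :: nat where K: "0 < K" "1 / real K < \<epsilon>"
    by (metis inverse_eq_divide zero_less_Suc)
  obtain R where R: "correlation M N R"
    and lev: "\<And>m n m' n'. (m, n) \<in> R \<Longrightarrow> (m', n') \<in> R \<Longrightarrow> level K M m m' = level K N n n' \<and>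
      (level_less K M m m' \<longleftrightarrow> level_less K N n n')"
    using UDLO_correlation[OF assms(1-4) K(1)] by blast
  have close: "\<bar>dst M m m' - dst N n n'\<bar> \<le> \<epsilon> \<and> \<bar>ray_dist M m m' - ray_dist N n n'\<bar> \<le> \<epsilon>"
    if mn: "(m, n) \<in> R" "(m', n') \<in> R" for m n m' n'
  proof -
    have pts: "m \<in> pts M" "m' \<in> pts M" "n \<in> pts N" "n' \<in> pts N"
      using mn R unfolding correlation_def by auto
    have d: "\<bar>dst M m m' - dst N n n'\<bar> \<le> 1 / real K"
      using lev[OF mn] by (intro dst_diff_le_of_level_eq[OF K(1)]) simp
    have r: "\<bar>ray_dist M m m' - ray_dist N n n'\<bar> \<le> 1 / real K"
    \<comment> \<open>At level 0 the two orders may disagree, but both values of \<open>r\<close>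
      lie between 0 and \<open>1 / K\<close>. At positive level the order agrees, so
      \<open>r\<close> is 0 on both sides or equals the distance on both sides.\<close>
    proof (cases "level K M m m' = 0")
      case True
      then have "real K * dst M m m' \<le> 1" "real K * dst N n n' \<le> 1"
        using level_bounds(1)[of K M m m'] level_bounds(1)[of K N n n'] lev[OF mn] by simp_all
      then have "dst M m m' \<le> 1 / real K" "dst N n n' \<le> 1 / real K"
        using K(1) by (simp_all add: field_simps)
      then have "0 \<le> ray_dist M m m'" "ray_dist M m m' \<le> 1 / real K"
        "0 \<le> ray_dist N n n'" "ray_dist N n n' \<le> 1 / real K"
        using M.ray_dist_eq[OF pts(1,2)] N.ray_dist_eq[OF pts(3,4)] by simp_all
      then show ?thesis by linarith
    next
      case False
      then have "(m, m') \<in> ord M \<longleftrightarrow> (n, n') \<in> ord N"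
        using lev[OF mn] unfolding level_less_def by auto
      then show ?thesis
        using M.ray_dist_eq[OF pts(1,2)] N.ray_dist_eq[OF pts(3,4)] d by simp
    qed
    from d r K(2) show ?thesis by linarith
  qed
  have base: "\<bar>eval \<phi> M m - eval \<phi> N n\<bar> \<le> \<epsilon>" if "\<phi> \<in> OGH" "\<And>i. (m i, n i) \<in> R" for \<phi> m n
    using that(1) close[OF that(2)[of 0] that(2)[of 1]] unfolding OGH_def by auto
  have "\<bar>eval \<phi> M m - eval \<phi> N n\<bar> \<le> \<epsilon>"
    if "\<phi> \<in> fm_closure (UDLO :: 'u ordered_metric set) OGH" "\<forall>i. (m i, n i) \<in> R" for \<phi> m n
  proof (rule fm_closure_distortion[OF that(1) assms(1,2) R])
    show "\<exists>C. \<forall>(M, e)\<in>valuations (UDLO :: 'u ordered_metric set). \<bar>eval \<psi> M e\<bar> \<le> C" if "\<psi> \<in> OGH" for \<psi>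
      using OGH_bounded[OF that] .
  qed (use base \<epsilon> that(2) in auto)
  then have "distortion (fm_closure (UDLO :: 'u ordered_metric set) OGH) M N R \<le> ereal \<epsilon>"
    unfolding distortion_def by (intro Sup_least) auto
  with R show ?thesis by blast
qed

theorem theorem5p21:
  shows "(\<forall>M\<in>(UDLO :: 'u ordered_metric set). \<forall>N\<in>(UDLO :: 'u ordered_metric set). \<forall>\<epsilon>::real.
            separable M \<and> separable N \<and> \<epsilon> > 0 \<longrightarrow>
            (\<exists>R. correlation M N R \<and>
               distortion (fm_closure (UDLO :: 'u ordered_metric set) OGH) M N R \<le> ereal \<epsilon>)) \<and>
         strongly_omega_categorical (fm_closure (UDLO :: 'u ordered_metric set) OGH)
           (UDLO :: 'u ordered_metric set)"
proof (intro conjI)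
  let ?\<Delta> = "fm_closure (UDLO :: 'u ordered_metric set) OGH"
  show "\<forall>M\<in>(UDLO :: 'u ordered_metric set). \<forall>N\<in>(UDLO :: 'u ordered_metric set). \<forall>\<epsilon>::real.
      separable M \<and> separable N \<and> \<epsilon> > 0 \<longrightarrow> (\<exists>R. correlation M N R \<and> distortion ?\<Delta> M N R \<le> ereal \<epsilon>)"
    using UDLO_distortion by blast
  have rho_0: "rho ?\<Delta> M N = 0"
    if MN: "M \<in> UDLO" "N \<in> UDLO" "separable M" "separable N" for M N :: "'u ordered_metric"
  proof (rule antisym)
    show "rho ?\<Delta> M N \<le> 0"
    proof (rule ereal_le_epsilon2)
      fix \<epsilon> :: real assume "0 < \<epsilon>"
      then obtain R where "correlation M N R" "distortion ?\<Delta> M N R \<le> ereal \<epsilon>"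
        using UDLO_distortion[OF MN] by blast
      then have "rho ?\<Delta> M N \<le> ereal \<epsilon>"
        unfolding rho_def by (blast intro: Inf_lower2)
      then show "rho ?\<Delta> M N \<le> 0 + ereal \<epsilon>" by simp
    qed
    \<comment> \<open>A supremum over the empty set would be minus infinity in \<open>ereal\<close>.
      One related pair, repeated as constant tuples, provides a nonnegative member through
      \<open>Dist 0 1\<close>.\<close>
    show "0 \<le> rho ?\<Delta> M N"
      unfolding rho_def
    proof (rule Inf_greatest, clarify)
      fix R assume R: "correlation M N R"
      interpret M: UDLO_model M by unfold_locales fact
      obtain m n where mn: "(m, n) \<in> R"
        using M.pts_nonempty R unfolding correlation_def by blast
      have "Dist 0 1 \<in> ?\<Delta>"
        by (rule fm_closure.base) (simp add: OGH_def)
      then have "ereal \<bar>eval (Dist 0 1) M (\<lambda>_. m) - eval (Dist 0 1) N (\<lambda>_. n)\<bar> \<le> distortion ?\<Delta> M N R"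
        unfolding distortion_def using mn by (intro Sup_upper) blast
      then show "0 \<le> distortion ?\<Delta> M N R"
        by (rule order_trans[rotated]) simp
    qed
  qed
  show "strongly_omega_categorical ?\<Delta> (UDLO :: 'u ordered_metric set)"
    unfolding strongly_omega_categorical_def density_character_omega_def
    by (intro ballI impI rho_0) simp_all
qed

end
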